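(* Let $N \geq 2$ and let $a_1,\dots,a_N$ be positive integers with $\gcd(a_1,\dots,a_N)=1$; write ${\boldsymbol a}=(a_1,\dots,a_N)$. For every integer $$s \geq \frac{\left( 4 \lambda_{N-1} \sum_{i=1}^N \|{\boldsymbol \alpha}_i\| a_i\right)^{N-1} (N-1)^{\frac{3N^2-1}{2}}}{(N-1)! \ \|{\boldsymbol a}\|^{N-2} R_{{\boldsymbol a}} \prod_{i=1}^N a_i}$$ one has $$g_s({\boldsymbol a}) \geq \frac{\left( (N-2)! \right)^{\frac{1}{N-1}}}{4 (N-1)^{\frac{3(N+1)}{2}}} \left( \frac{s R_{{\boldsymbol a}} \prod_{i=1}^N a_i}{\|{\boldsymbol a}\|} \right)^{\frac{1}{N-1}}.$$
   Context: A positive integer $t$ is representable by ${\boldsymbol a}$ if $t=\sum_{i=1}^N a_ix_i$ with $x_1,\dots,x_N$ nonnegative integers; each such ${\boldsymbol x}$ is a representation of $t$. For an integer $s\ge 0$, the $s$-Frobenius number $g_s({\boldsymbol a})$ is the largest positive integer that has precisely $s$ distinct representations in terms of ${\boldsymbol a}$. $\|\cdot\|$ is the Euclidean norm, and ${\boldsymbol \alpha}_i := (a_1,\dots,a_{i-1},a_{i+1},\dots,a_N)$. Let $\Lambda_{{\boldsymbol a}} = \{{\boldsymbol x}\in\mathbb{Z}^N : \sum_{i} a_ix_i=0\}$ and $V_{{\boldsymbol a}}=\operatorname{span}_{\mathbb R}\Lambda_{{\boldsymbol a}}$ (dimension $N-1$), with $B_{V_{{\boldsymbol a}}}(R)$ the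 closed ball of radius $R$ centered at the origin in $V_{{\boldsymbol a}}$. The covering radius is $R_{{\boldsymbol a}} := \inf\{R>0 : \Lambda_{{\boldsymbol a}} + B_{V_{{\boldsymbol a}}}(R) = V_{{\boldsymbol a}}\}$. The $(N-1)$-th successive minimum is $\lambda_{N-1} := \min\{\lambda\in\mathbb{R} : \dim \operatorname{span}_{\mathbb R}(B_{V_{{\boldsymbol a}}}(\lambda)\cap\Lambda_{{\boldsymbol a}}) \ge N-1\}$.
   Formalization: The theorem assumes in addition that some positive integer has precisely s representations, since otherwise g_s(a) does not exist (e.g. a = (1,1,1) with s not a triangular number). *)

theory Defs
  imports "HOL-Analysis.Analysis"
begin

definition representations :: "nat ^ 'n \<Rightarrow> nat \<Rightarrow> (nat ^ 'n) set" where
  "representations a t = {x. (\<Sum>i\<in>UNIV. a $ i * x $ i) = t}"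

text \<open>For positive \<open>a\<close> every set of representations is finite, so that \<open>card\<close> below is a true count.\<close>

lemma finite_representations:
  fixes a :: "nat ^ 'n"
  assumes "\<And>i. 0 < a $ i"
  shows "finite (representations a t)"
proof (rule finite_subset)
  show "representations a t \<subseteq> (\<lambda>f. \<chi> i. f i) ` (UNIV \<rightarrow>\<^sub>E {..t})"
  proof
    fix x assume x: "x \<in> representations a t"
    have "x $ i \<le> t" for i
    proof -
      have "x $ i \<le> a $ i * x $ i"
        using assms[of i] by simp
      also have "\<dots> \<le> (\<Sum>i\<in>UNIV. a $ i * x $ i)"
        by (rule member_le_sum) auto
      finally show ?thesis
        using x by (simp add: representations_def)
    qed
    then have "($) x \<in> UNIV \<rightarrow>\<^sub>E {..t}"
      by auto
    moreover have "x = (\<chi> i. x $ i)"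
      by simp
    ultimately show "x \<in> (\<lambda>f. \<chi> i. f i) ` (UNIV \<rightarrow>\<^sub>E {..t})"
      by blast
  qed
  show "finite ((\<lambda>f. \<chi> i. f i) ` (UNIV \<rightarrow>\<^sub>E {..t}) :: (nat ^ 'n) set)"
    by (intro finite_imageI finite_PiE) auto
qed

text \<open>The value is meaningful only if some positive integer has exactly \<open>s\<close> representations,
  which can fail: for \<open>a = (1, 1, 1)\<close> only triangular numbers \<open>s\<close> occur.\<close>

definition s_Frobenius :: "nat \<Rightarrow> nat ^ 'n \<Rightarrow> nat" where
  "s_Frobenius s a = Max {t. 0 < t \<and> card (representations a t) = s}"

definition real_vec :: "nat ^ 'n \<Rightarrow> real ^ 'n" where
  "real_vec a = (\<chi> i. real (a $ i))"

text \<open>The Euclidean norm of the vector obtained from \<open>a\<close> by deleting its \<open>i\<close>-th entry.\<close>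

definition norm_delete :: "nat ^ 'n \<Rightarrow> 'n \<Rightarrow> real" where
  "norm_delete a i = L2_set (\<lambda>j. real (a $ j)) (UNIV - {i})"

definition orth_lattice :: "nat ^ 'n \<Rightarrow> (real ^ 'n) set" where
  "orth_lattice a = {x. (\<forall>i. x $ i \<in> \<int>) \<and> (\<Sum>i\<in>UNIV. real (a $ i) * x $ i) = 0}"

definition lattice_space :: "nat ^ 'n \<Rightarrow> (real ^ 'n) set" where
  "lattice_space a = span (orth_lattice a)"

definition lattice_ball :: "nat ^ 'n \<Rightarrow> real \<Rightarrow> (real ^ 'n) set" where
  "lattice_ball a r = cball 0 r \<inter> lattice_space a"

definition covering_radius :: "nat ^ 'n \<Rightarrow> real" where
  "covering_radius a =
    Inf {r. 0 < r \<and> {x + y | x y. x \<in> orth_lattice a \<and> y \<in> lattice_ball a r} = lattice_space a}"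

definition successive_minimum :: "nat ^ 'n \<Rightarrow> nat \<Rightarrow> real" where
  "successive_minimum a k = (LEAST l. k \<le> dim (span (lattice_ball a l \<inter> orth_lattice a)))"

end

theory Submission
  imports Defs
begin

text \<open>
  Put \<open>n = N - 1\<close> and \<open>T = \<lambda>\<^sub>n \<cdot> (\<Sum>i. \<parallel>\<alpha>\<^sub>i\<parallel> a\<^sub>i) / \<parallel>a\<parallel>\<close>. Rounding the incenter of the simplex
  \<open>x \<ge> 0\<close>, \<open>a \<bullet> x = t\<close> to the lattice shows that every \<open>t \<ge> n T / 2\<close> is representable. Hence the number
  \<open>p(t)\<close> of representations satisfies \<open>p(t) \<le> p(t + d)\<close> for all \<open>d \<ge> n T / 2\<close>, and averaging over \<open>d\<close>
  bounds \<open>p(t)\<close> by the number of integer points of a slightly larger full-dimensional simplex. Together with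
  \<open>R\<^sub>a \<le> n \<parallel>a\<parallel> / 2\<close> this gives \<open>(n - 1)! p(t) R\<^sub>a \<Prod>a\<^sub>i / \<parallel>a\<parallel> < (4 c max(t, T))\<^sup>n\<close> where
  \<open>c\<close> is \<open>n\<close> to the power \<open>3(N + 1)/2\<close>. The
  lower bound on \<open>s = p(t)\<close> says that the left-hand side is at least \<open>(4 c T)\<^sup>n\<close>, so \<open>t > T\<close> and the bound on
  \<open>t\<close> follows. It applies to \<open>g\<^sub>s(a)\<close> because only finitely many \<open>t\<close> have \<open>p(t) = s\<close>, so that the maximum is
  attained.
\<close>

section \<open>Counting integer points of a simplex\<close>

lemma power_Bernoulli_step:
  fixes u h :: real
  assumes "0 \<le> u" "0 \<le> h"
  shows "u ^ m * (real (Suc m) * h) + u ^ Suc m \<le> (u + h) ^ Suc m"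
proof (induction m)
  case (Suc m)
  have "u ^ Suc m * (real (Suc (Suc m)) * h) + u ^ Suc (Suc m)
      = (u + h) * (u ^ m * (real (Suc m) * h) + u ^ Suc m) - u ^ m * real (Suc m) * h\<^sup>2"
    by (simp add: algebra_simps power2_eq_square)
  also have "\<dots> \<le> (u + h) * (u ^ m * (real (Suc m) * h) + u ^ Suc m)"
    using assms by simp
  also have "\<dots> \<le> (u + h) * (u + h) ^ Suc m"
    using Suc assms by (intro mult_left_mono) auto
  finally show ?case by simp
qed simp

text \<open>A discrete integral of x^m: by \<open>power_Bernoulli_step\<close> at u = A - k h, each
  summand times (m + 1) h is at most (u + h)^(m+1) - u^(m+1), and these differences telescope. The
  second term on the left is the lower end of the telescope, kept for the induction.\<close>

lemma sum_arithmetic_powers_le: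
  fixes A h :: real
  assumes "0 \<le> h" "real K * h \<le> A"
  shows "(\<Sum>k\<le>K. (A - real k * h) ^ m) * (real (Suc m) * h) + (A - real K * h) ^ Suc m
    \<le> (A + h) ^ Suc m"
  using assms(2)
proof (induction K)
  case 0
  then show ?case
    using power_Bernoulli_step[of A h m] assms by simp
next
  case (Suc K)
  define u where "u = A - real (Suc K) * h"
  have u: "A - real K * h = u + h"
    by (simp add: u_def algebra_simps)
  have K: "real K * h \<le> A"
    using Suc.prems assms by (simp add: algebra_simps)
  have "u ^ m * (real (Suc m) * h) + u ^ Suc m \<le> (u + h) ^ Suc m"
    using Suc.prems assms by (intro power_Bernoulli_step) (auto simp: u_def)
  moreover have "(\<Sum>k\<le>Suc K. (A - real k * h) ^ m) = (\<Sum>k\<le>K. (A - real k * h) ^ m) + u ^ m"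
    unfolding u_def by (rule sum.atMost_Suc)
  ultimately show ?case
    using Suc.IH[OF K] unfolding u u_def[symmetric] by (simp only: distrib_right)
qed

text \<open>Unit cubes attached to the points lie in the simplex enlarged to T +
  \<open>sum w I\<close>, whose volume gives the bound. The proof replaces volumes by slicing along
  one coordinate at a time.\<close>

lemma card_weighted_sum_le:
  fixes w :: "'a \<Rightarrow> nat"
  assumes "finite I" "\<And>i. i \<in> I \<Longrightarrow> 0 < w i"
  shows "finite {z \<in> I \<rightarrow>\<^sub>E UNIV. (\<Sum>i\<in>I. w i * z i) \<le> T} \<and>
    real (card {z \<in> I \<rightarrow>\<^sub>E UNIV. (\<Sum>i\<in>I. w i * z i) \<le> T}) * (fact (card I) * (\<Prod>i\<in>I. real (w i)))
      \<le> real (T + sum w I) ^ card I"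
  using assms
proof (induction I arbitrary: T rule: finite_induct)
  case empty
  then show ?case by simp
next
  case (insert j I)
  let ?S = "\<lambda>T. {z \<in> I \<rightarrow>\<^sub>E UNIV. (\<Sum>i\<in>I. w i * z i) \<le> T}"
  let ?S' = "{z \<in> insert j I \<rightarrow>\<^sub>E UNIV. (\<Sum>i\<in>insert j I. w i * z i) \<le> T}"
  define K where "K = T div w j"
  define m where "m = card I"
  define P where "P = (\<Prod>i\<in>I. real (w i))"
  have wj: "0 < w j" using insert by auto
  have IH: "finite (?S T)" "real (card (?S T)) * (fact m * P) \<le> real (T + sum w I) ^ m" for T
    using insert.IH[of T] insert.prems by (auto simp: m_def P_def)
  \<comment> \<open>Slice by the value k of coordinate j. Resetting that coordinate to
    \<open>undefined\<close> leaves a point of the lower-dimensional simplex.\<close>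
  have cover: "?S' \<subseteq> (\<Union>k\<le>K. (\<lambda>z. z(j := k)) ` ?S (T - w j * k))"
  proof
    fix z assume z: "z \<in> ?S'"
    have sum: "(\<Sum>i\<in>insert j I. w i * z i) = w j * z j + (\<Sum>i\<in>I. w i * (z(j := undefined)) i)"
      using insert.hyps by (auto intro!: sum.cong)
    have "w j * z j \<le> T"
      using z sum by auto
    then have "z j \<le> K"
      using wj by (simp add: K_def less_eq_div_iff_mult_less_eq mult.commute)
    moreover have "z(j := undefined) \<in> ?S (T - w j * z j)"
      using z sum insert.hyps by (auto simp: PiE_def extensional_def)
    moreover have "z = (z(j := undefined))(j := z j)"
      by auto
    ultimately show "z \<in> (\<Union>k\<le>K. (\<lambda>z. z(j := k)) ` ?S (T - w j * k))"
      by blast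
  qed
  have fin: "finite (\<Union>k\<le>K. (\<lambda>z. z(j := k)) ` ?S (T - w j * k))"
    using IH(1) by blast
  have "card ?S' \<le> (\<Sum>k\<le>K. card ((\<lambda>z. z(j := k)) ` ?S (T - w j * k)))"
    by (rule order_trans[OF card_mono[OF fin cover] card_UN_le]) simp
  also have "\<dots> \<le> (\<Sum>k\<le>K. card (?S (T - w j * k)))"
    by (intro sum_mono card_image_le IH(1))
  finally have "real (card ?S') \<le> (\<Sum>k\<le>K. real (card (?S (T - w j * k))))"
    unfolding of_nat_sum[symmetric] of_nat_le_iff .
  moreover have "P \<ge> 0"
    by (simp add: P_def prod_nonneg)
  ultimately have "real (card ?S') * (fact m * P) \<le> (\<Sum>k\<le>K. real (card (?S (T - w j * k))) * (fact m * P))"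
    by (simp add: mult_right_mono flip: sum_distrib_right)
  \<comment> \<open>For k at most K the truncated subtraction is exact, so the slice bounds are
    powers of an arithmetic progression with step \<open>w j\<close>.\<close>
  also have "\<dots> \<le> (\<Sum>k\<le>K. (real (T + sum w I) - real k * real (w j)) ^ m)"
  proof (rule sum_mono)
    fix k assume "k \<in> {..K}"
    then have "w j * k \<le> T"
      using wj by (simp add: K_def less_eq_div_iff_mult_less_eq mult.commute)
    then have "real (T - w j * k + sum w I) = real (T + sum w I) - real k * real (w j)"
      by (simp add: of_nat_diff algebra_simps)
    then show "real (card (?S (T - w j * k))) * (fact m * P)
        \<le> (real (T + sum w I) - real k * real (w j)) ^ m"
      using IH(2)[of "T - w j * k"] by (simp only:)
  qed
  \<comment> \<open>The new factor extends the factorial and the product of weights from I to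
    \<open>insert j I\<close>.\<close>
  finally have "real (card ?S') * (fact m * P) * (real (Suc m) * real (w j))
      \<le> (\<Sum>k\<le>K. (real (T + sum w I) - real k * real (w j)) ^ m) * (real (Suc m) * real (w j))"
    by (rule mult_right_mono) simp
  also have "\<dots> \<le> (real (T + sum w I) + real (w j)) ^ Suc m"
  proof -
    have "K * w j \<le> T"
      by (simp add: K_def)
    then have K: "real K * real (w j) \<le> real (T + sum w I)"
      by (metis of_nat_mult of_nat_le_iff trans_le_add1)
    then have "0 \<le> (real (T + sum w I) - real K * real (w j)) ^ Suc m"
      by simp
    then show ?thesis
      using sum_arithmetic_powers_le[of "real (w j)" K "real (T + sum w I)" m] K by linarith
  qed
  finally show ?case
    using finite_subset[OF cover fin] insert.hyps
    by (simp add: m_def P_def algebra_simps)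
qed

lemma card_weighted_vec_le:
  fixes a :: "nat ^ 'n"
  assumes "\<And>i. 0 < a $ i"
  defines "S \<equiv> \<lambda>T. {z. (\<Sum>i\<in>UNIV. a $ i * z $ i) \<le> T}"
  shows "finite (S T)"
    and "real (card (S T)) * (fact CARD('n) * (\<Prod>i\<in>UNIV. real (a $ i)))
      \<le> real (T + (\<Sum>i\<in>UNIV. a $ i)) ^ CARD('n)"
proof -
  let ?F = "{z \<in> UNIV \<rightarrow>\<^sub>E UNIV. (\<Sum>i\<in>UNIV. a $ i * z i) \<le> T}"
  have F: "bij_betw vec_nth (S T) ?F"
    unfolding S_def by (rule bij_betwI[where g = vec_lambda]) auto
  show "finite (S T)"
    using card_weighted_sum_le[of UNIV "\<lambda>i. a $ i" T] assms bij_betw_finite[OF F] by auto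
  show "real (card (S T)) * (fact CARD('n) * (\<Prod>i\<in>UNIV. real (a $ i)))
      \<le> real (T + (\<Sum>i\<in>UNIV. a $ i)) ^ CARD('n)"
    using card_weighted_sum_le[of UNIV "\<lambda>i. a $ i" T] assms bij_betw_same_card[OF F] by auto
qed

text \<open>Coprimality enters through this identity: it yields an integer point, with signs
  unrestricted, on every hyperplane a . x = t.\<close>

lemma bezout_finite_family:
  fixes a :: "'a \<Rightarrow> nat"
  assumes "finite I"
  shows "\<exists>c. (\<Sum>i\<in>I. c i * int (a i)) = int (Gcd (a ` I))"
  using assms
proof (induction I rule: finite_induct)
  case (insert j I)
  then obtain c where c: "(\<Sum>i\<in>I. c i * int (a i)) = int (Gcd (a ` I))"
    by blast
  obtain u v where uv: "u * int (a j) + v * int (Gcd (a ` I)) = gcd (int (a j)) (int (Gcd (a ` I)))"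
    using bezout_int by blast
  let ?c = "(\<lambda>i. v * c i)(j := u)"
  have "(\<Sum>i\<in>I. ?c i * int (a i)) = v * (\<Sum>i\<in>I. c i * int (a i))"
    unfolding sum_distrib_left using insert.hyps by (intro sum.cong) auto
  then have "(\<Sum>i\<in>insert j I. ?c i * int (a i)) = int (Gcd (a ` insert j I))"
    using insert.hyps uv c by (simp add: gcd_int_int_eq)
  then show ?case by blast
qed simp

section \<open>The lattice orthogonal to a, its last successive minimum and its covering
  radius\<close>

lemma real_vec_inner: "real_vec a \<bullet> x = (\<Sum>i\<in>UNIV. real (a $ i) * x $ i)"
  by (simp add: real_vec_def inner_vec_def)

lemma orth_lattice_iff: "x \<in> orth_lattice a \<longleftrightarrow> (\<forall>i. x $ i \<in> \<int>) \<and> real_vec a \<bullet> x = 0"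
  by (simp add: orth_lattice_def real_vec_inner)

lemma orth_lattice_sum_Ints:
  assumes "\<And>b. b \<in> B \<Longrightarrow> b \<in> orth_lattice a" "\<And>b. k b \<in> \<int>"
  shows "(\<Sum>b\<in>B. k b *\<^sub>R b) \<in> orth_lattice a"
  using assms by (auto simp: orth_lattice_iff inner_sum_right intro!: Ints_sum Ints_mult)

lemma norm_real_vec_pos:
  assumes "\<And>i. 0 < a $ i"
  shows "0 < norm (real_vec a)"
  using assms by (auto simp: real_vec_def vec_eq_iff dest: less_imp_neq)

lemma norm_vec_sq: "(norm (x :: real ^ 'n))\<^sup>2 = (\<Sum>i\<in>UNIV. (x $ i)\<^sup>2)"
  by (simp add: norm_vec_def L2_set_def sum_nonneg)

text \<open>For fixed i the lattice vectors a_i e_j - a_j e_i with j distinct from i span the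
  hyperplane, and each has norm at most that of a. This gives both full rank and an upper bound for
  the successive minimum.\<close>

lemma hyperplane_subset_span:
  fixes a :: "nat ^ 'n"
  assumes "\<And>i. 0 < a $ i"
  shows "{x. real_vec a \<bullet> x = 0} \<subseteq> span (cball 0 (norm (real_vec a)) \<inter> orth_lattice a)"
proof
  fix w :: "real ^ 'n" assume "w \<in> {x. real_vec a \<bullet> x = 0}"
  then have w: "(\<Sum>i\<in>UNIV. real (a $ i) * w $ i) = 0"
    by (simp add: real_vec_inner)
  fix i :: 'n
  define v where "v j = real (a $ i) *\<^sub>R axis j 1 - real (a $ j) *\<^sub>R axis i (1::real)" for j
  have v_nth: "v j $ l = (if l = j then real (a $ i) else 0) - (if l = i then real (a $ j) else 0)" for j l
    by (auto simp: v_def axis_def)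
  have v_lattice: "v j \<in> orth_lattice a" for j
    by (auto simp: orth_lattice_def v_nth algebra_simps sum_subtractf if_distrib[of "\<lambda>x. _ * x"] cong: if_cong)
  have v_norm: "norm (v j) \<le> norm (real_vec a)" if "j \<noteq> i" for j
  proof -
    have "(norm (v j))\<^sup>2 = (\<Sum>l\<in>{i, j}. (v j $ l)\<^sup>2)"
      unfolding norm_vec_sq by (rule sum.mono_neutral_right) (auto simp: v_nth)
    also have "\<dots> = (\<Sum>l\<in>{i, j}. (real (a $ l))\<^sup>2)"
      using that by (simp add: v_nth)
    also have "\<dots> \<le> (norm (real_vec a))\<^sup>2"
      unfolding norm_vec_sq real_vec_def by (auto intro!: sum_mono2)
    finally show ?thesis
      by (rule power2_le_imp_le) simp
  qed
  \<comment> \<open>Among these vectors only \<open>v j\<close> has a nonzero entry at j, which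
    fixes the coefficients; the entry at i then agrees because w is orthogonal to a.\<close>
  have "w = (\<Sum>j\<in>UNIV - {i}. (w $ j / real (a $ i)) *\<^sub>R v j)"
  proof (rule vec_eq_iff[THEN iffD2], rule allI)
    fix l
    have ai: "real (a $ i) \<noteq> 0"
      using assms[of i] by simp
    have rest: "(\<Sum>j\<in>UNIV - {i}. real (a $ j) * w $ j) = - (real (a $ i) * w $ i)"
      using w by (simp add: sum_diff1)
    show "w $ l = (\<Sum>j\<in>UNIV - {i}. (w $ j / real (a $ i)) *\<^sub>R v j) $ l"
    proof (cases "l = i")
      case True
      have "(\<Sum>j\<in>UNIV - {i}. w $ j / real (a $ i) * v j $ i)
          = (\<Sum>j\<in>UNIV - {i}. - (real (a $ j) * w $ j) / real (a $ i))"
        by (rule sum.cong) (auto simp: v_nth)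
      also have "\<dots> = w $ i"
        using ai by (simp only: flip: sum_divide_distrib) (simp add: sum_negf rest)
      finally show ?thesis
        using True by simp
    next
      case False
      have "(\<Sum>j\<in>UNIV - {i}. w $ j / real (a $ i) * v j $ l)
          = (\<Sum>j\<in>UNIV - {i}. if l = j then w $ j else 0)"
        using ai False by (intro sum.cong) (auto simp: v_nth)
      then show ?thesis
        using False by simp
    qed
  qed
  also have "\<dots> \<in> span (cball 0 (norm (real_vec a)) \<inter> orth_lattice a)"
    using v_lattice v_norm by (intro span_sum span_scale span_base) auto
  finally show "w \<in> span (cball 0 (norm (real_vec a)) \<inter> orth_lattice a)" .
qed

lemma lattice_space_eq:
  fixes a :: "nat ^ 'n"
  assumes "\<And>i. 0 < a $ i"
  shows "lattice_space a = {x. real_vec a \<bullet> x = 0}"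
proof
  show "lattice_space a \<subseteq> {x. real_vec a \<bullet> x = 0}"
    unfolding lattice_space_def
    by (rule span_minimal) (auto simp: orth_lattice_iff subspace_hyperplane)
  show "{x. real_vec a \<bullet> x = 0} \<subseteq> lattice_space a"
    using hyperplane_subset_span[OF assms] span_mono[of "_ \<inter> orth_lattice a" "orth_lattice a"]
    unfolding lattice_space_def by fastforce
qed

lemma dim_lattice_space:
  fixes a :: "nat ^ 'n"
  assumes "\<And>i. 0 < a $ i"
  shows "dim (lattice_space a) = CARD('n) - 1"
  using norm_real_vec_pos[OF assms] by (simp add: lattice_space_eq[OF assms] dim_hyperplane)

lemma lattice_ball_Int: "lattice_ball a r \<inter> orth_lattice a = cball 0 r \<inter> orth_lattice a"
  by (auto simp: lattice_ball_def lattice_space_def span_base)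

lemma orth_lattice_norm_sq:
  assumes "x \<in> orth_lattice a"
  obtains m :: nat where "(norm x)\<^sup>2 = real m"
proof -
  have "(norm x)\<^sup>2 \<in> \<int>"
    using assms by (auto simp: norm_vec_sq orth_lattice_iff intro!: Ints_sum Ints_power)
  then have "(norm x)\<^sup>2 \<in> \<nat>"
    by (simp add: Nats_altdef2)
  then show ?thesis
    using that by (auto elim: Nats_cases)
qed

text \<open>\<open>LEAST\<close> over the reals says something only once the minimum is attained.
  Squared norms of lattice vectors are integers, so only radii that are square roots of naturals
  matter, and the naturals are well-ordered.\<close>

lemma successive_minimum_spec:
  fixes a :: "nat ^ 'n"
  assumes pos: "\<And>i. 0 < a $ i" and N: "2 \<le> CARD('n)"
  defines "l \<equiv> successive_minimum a (CARD('n) - 1)"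
  shows "span (cball 0 l \<inter> orth_lattice a) = lattice_space a"
    and "0 \<le> l" and "l \<le> norm (real_vec a)"
proof -
  define Q where "Q r \<longleftrightarrow> CARD('n) - 1 \<le> dim (span (cball 0 r \<inter> orth_lattice a))" for r
  have l: "l = (LEAST r. Q r)"
    by (simp add: l_def successive_minimum_def lattice_ball_Int Q_def)
  have Q_norm: "Q (norm (real_vec a))"
    using dim_subset[OF hyperplane_subset_span[OF pos]] dim_lattice_space[OF pos]
    by (simp add: Q_def lattice_space_eq[OF pos])
  \<comment> \<open>A ball of negative radius is empty and spans dimension 0, which is below N -
    1.\<close>
  have Q_nonneg: "0 \<le> r" if "Q r" for r
  proof (rule ccontr)
    assume "\<not> 0 \<le> r"
    then show False
      using that N by (simp add: Q_def cball_empty)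
  qed
  have Q_floor: "Q (sqrt (real (nat \<lfloor>r\<^sup>2\<rfloor>)))" if "Q r" for r
  proof -
    have "cball 0 r \<inter> orth_lattice a \<subseteq> cball 0 (sqrt (real (nat \<lfloor>r\<^sup>2\<rfloor>)))"
    proof
      fix x assume x: "x \<in> cball 0 r \<inter> orth_lattice a"
      obtain m where m: "(norm x)\<^sup>2 = real m"
        using x orth_lattice_norm_sq by blast
      have "(norm x)\<^sup>2 \<le> r\<^sup>2"
        using x by (intro power_mono) auto
      then have "m \<le> nat \<lfloor>r\<^sup>2\<rfloor>"
        using m by (simp add: le_nat_floor)
      then have "(norm x)\<^sup>2 \<le> real (nat \<lfloor>r\<^sup>2\<rfloor>)"
        unfolding m by (rule of_nat_mono)
      then show "x \<in> cball 0 (sqrt (real (nat \<lfloor>r\<^sup>2\<rfloor>)))"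
        by (simp add: real_le_rsqrt)
    qed
    then have "span (cball 0 r \<inter> orth_lattice a)
        \<subseteq> span (cball 0 (sqrt (real (nat \<lfloor>r\<^sup>2\<rfloor>))) \<inter> orth_lattice a)"
      by (intro span_mono) auto
    from dim_subset[OF this] that show ?thesis
      by (simp add: Q_def)
  qed
  define m where "m = (LEAST m. Q (sqrt (real m)))"
  have Q_m: "Q (sqrt (real m))"
    unfolding m_def using Q_floor[OF Q_norm] by (rule LeastI)
  have m_le: "sqrt (real m) \<le> r" if "Q r" for r
  proof -
    have "m \<le> nat \<lfloor>r\<^sup>2\<rfloor>"
      unfolding m_def using Q_floor[OF that] by (rule Least_le)
    then have "real m \<le> r\<^sup>2"
      by (metis le_nat_iff of_nat_floor of_nat_le_iff order_trans zero_le_power2)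
    then show ?thesis
      using Q_nonneg[OF that] by (simp add: real_le_lsqrt)
  qed
  have l_eq: "l = sqrt (real m)"
    unfolding l using Q_m m_le by (rule Least_equality)
  show "0 \<le> l" "l \<le> norm (real_vec a)"
    using m_le[OF Q_norm] l_eq by auto
  show "span (cball 0 l \<inter> orth_lattice a) = lattice_space a"
  proof (rule subspace_dim_equal)
    show "span (cball 0 l \<inter> orth_lattice a) \<subseteq> lattice_space a"
      unfolding lattice_space_def by (intro span_mono) auto
    show "dim (lattice_space a) \<le> dim (span (cball 0 l \<inter> orth_lattice a))"
      using Q_m by (simp add: dim_lattice_space[OF pos] Q_def l_eq)
  qed (auto simp: lattice_space_def)
qed

text \<open>Expand w in a basis of lattice vectors of norm at most the successive minimum and round
  the coefficients: each of the N - 1 terms contributes an error of at most half that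
  minimum.\<close>

lemma lattice_rounding:
  fixes a :: "nat ^ 'n"
  assumes pos: "\<And>i. 0 < a $ i" and N: "2 \<le> CARD('n)" and w: "w \<in> lattice_space a"
  obtains y where "y \<in> orth_lattice a"
    "norm (w - y) \<le> real (CARD('n) - 1) / 2 * successive_minimum a (CARD('n) - 1)"
proof -
  define l where "l = successive_minimum a (CARD('n) - 1)"
  define S where "S = cball 0 l \<inter> orth_lattice a"
  have S: "span S = lattice_space a"
    unfolding S_def l_def by (rule successive_minimum_spec(1)[OF pos N])
  obtain B where B: "B \<subseteq> S" "independent B" "S \<subseteq> span B" "card B = dim S"
    using basis_exists[of S] by metis
  have "finite B"
    using B(2) by (rule independent_imp_finite)
  have cardB: "card B = CARD('n) - 1"
    using dim_lattice_space[OF pos] S B(4) by (metis dim_span)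
  have "w \<in> span B"
    using w S B(3) span_minimal subspace_span by blast
  then obtain u where u: "w = (\<Sum>b\<in>B. u b *\<^sub>R b)"
    using span_finite[OF \<open>finite B\<close>] by auto
  define y where "y = (\<Sum>b\<in>B. real_of_int (round (u b)) *\<^sub>R b)"
  have "y \<in> orth_lattice a"
    unfolding y_def using B(1) by (intro orth_lattice_sum_Ints) (auto simp: S_def)
  moreover have "norm (w - y) \<le> real (CARD('n) - 1) / 2 * l"
  proof -
    have "w - y = (\<Sum>b\<in>B. (u b - real_of_int (round (u b))) *\<^sub>R b)"
      by (simp add: u y_def sum_subtractf scaleR_diff_left)
    also have "norm \<dots> \<le> (\<Sum>b\<in>B. 1 / 2 * l)"
    proof (rule sum_norm_le)
      fix b assume "b \<in> B"
      then have "norm b \<le> l"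
        using B(1) by (auto simp: S_def)
      moreover have "\<bar>u b - real_of_int (round (u b))\<bar> \<le> 1 / 2"
        using of_int_round_abs_le[of "u b"] by (simp add: abs_minus_commute)
      ultimately show "norm ((u b - real_of_int (round (u b))) *\<^sub>R b) \<le> 1 / 2 * l"
        unfolding norm_scaleR by (intro mult_mono) auto
    qed
    finally show ?thesis
      by (simp add: cardB)
  qed
  ultimately show ?thesis
    using that unfolding l_def by blast
qed

text \<open>By rounding, the stated upper bound is itself an admissible radius. It is phrased with
  the norm of a, which later cancels against the norm in the denominator.\<close>

lemma covering_radius_bounds:
  fixes a :: "nat ^ 'n"
  assumes pos: "\<And>i. 0 < a $ i" and N: "2 \<le> CARD('n)"
  shows "0 \<le> covering_radius a"
    and "covering_radius a \<le> real (CARD('n) - 1) / 2 * norm (real_vec a)"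
proof -
  define r where "r = real (CARD('n) - 1) / 2 * norm (real_vec a)"
  define C where "C = {r. 0 < r \<and>
    {x + y | x y. x \<in> orth_lattice a \<and> y \<in> lattice_ball a r} = lattice_space a}"
  have "{x + y | x y. x \<in> orth_lattice a \<and> y \<in> lattice_ball a r} = lattice_space a"
  proof safe
    fix x y assume "x \<in> orth_lattice a" "y \<in> lattice_ball a r"
    then show "x + y \<in> lattice_space a"
      by (auto simp: lattice_ball_def lattice_space_def intro: span_add span_base)
  next
    fix w assume w: "w \<in> lattice_space a"
    obtain y where y: "y \<in> orth_lattice a"
      "norm (w - y) \<le> real (CARD('n) - 1) / 2 * successive_minimum a (CARD('n) - 1)"
      using lattice_rounding[OF pos N w] .
    have "norm (w - y) \<le> r"
      unfolding r_def
      by (rule order_trans[OF y(2) mult_left_mono[OF successive_minimum_spec(3)[OF pos N]]]) simp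
    moreover have "w - y \<in> lattice_space a"
      using w y(1) by (auto simp: lattice_space_def intro: span_diff span_base)
    ultimately have "w - y \<in> lattice_ball a r"
      by (simp add: lattice_ball_def)
    moreover have "w = y + (w - y)"
      by simp
    ultimately show "\<exists>x y. w = x + y \<and> x \<in> orth_lattice a \<and> y \<in> lattice_ball a r"
      using y(1) by blast
  qed
  moreover have "0 < r"
    unfolding r_def using norm_real_vec_pos[OF pos] N by (intro mult_pos_pos) auto
  ultimately have r: "r \<in> C"
    by (simp add: C_def)
  have R: "covering_radius a = Inf C"
    by (simp add: covering_radius_def C_def)
  show "0 \<le> covering_radius a"
    unfolding R using r by (intro cInf_greatest) (auto simp: C_def)
  show "covering_radius a \<le> real (CARD('n) - 1) / 2 * norm (real_vec a)"
    unfolding R r_def[symmetric] using r by (intro cInf_lower bdd_belowI[of _ 0]) (auto simp: C_def)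
qed


section \<open>Coordinates in the hyperplane and representability of large integers\<close>

lemma lattice_space_coordinate_le:
  fixes a :: "nat ^ 'n"
  assumes pos: "\<And>i. 0 < a $ i" and w: "w \<in> lattice_space a"
  shows "norm (real_vec a) * \<bar>w $ i\<bar> \<le> norm_delete a i * norm w"
proof (rule power2_le_imp_le)
  define D where "D = norm_delete a i"
  define W where "W = L2_set (\<lambda>j. w $ j) (UNIV - {i})"
  have split: "(norm x)\<^sup>2 = (x $ i)\<^sup>2 + (L2_set (\<lambda>j. x $ j) (UNIV - {i}))\<^sup>2" for x :: "real ^ 'n"
    by (simp add: norm_vec_sq L2_set_def sum_nonneg sum.remove[of UNIV i])
  have A: "(norm (real_vec a))\<^sup>2 = (real (a $ i))\<^sup>2 + D\<^sup>2"
    using split[of "real_vec a"] by (simp add: real_vec_def D_def norm_delete_def)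
  have W: "(norm w)\<^sup>2 = (w $ i)\<^sup>2 + W\<^sup>2"
    using split[of w] by (simp add: W_def)
  have "(\<Sum>j\<in>UNIV. real (a $ j) * w $ j) = 0"
    using w by (simp add: lattice_space_eq[OF pos] real_vec_inner)
  then have "real (a $ i) * w $ i = - (\<Sum>j\<in>UNIV - {i}. real (a $ j) * w $ j)"
    by (simp add: sum.remove[of UNIV i])
  then have "\<bar>real (a $ i) * w $ i\<bar> = \<bar>\<Sum>j\<in>UNIV - {i}. real (a $ j) * w $ j\<bar>"
    by simp
  also have "\<dots> \<le> (\<Sum>j\<in>UNIV - {i}. \<bar>real (a $ j)\<bar> * \<bar>w $ j\<bar>)"
    by (rule order_trans[OF sum_abs]) (simp add: abs_mult)
  also have "\<dots> \<le> D * W"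
    unfolding D_def W_def norm_delete_def by (rule L2_set_mult_ineq)
  finally have "(real (a $ i) * w $ i)\<^sup>2 \<le> (D * W)\<^sup>2"
    by (rule abs_le_square_iff[THEN iffD1, OF order_trans]) simp
  \<comment> \<open>Cauchy-Schwarz gave (a_i w_i)^2 at most D^2 W^2; adding D^2 w_i^2 to both sides
    turns the factors into full norms.\<close>
  then show "(norm (real_vec a) * \<bar>w $ i\<bar>)\<^sup>2 \<le> (norm_delete a i * norm w)\<^sup>2"
    by (simp add: power_mult_distrib A W D_def[symmetric] algebra_simps)
  show "0 \<le> norm_delete a i * norm w"
    by (simp add: norm_delete_def)
qed

text \<open>The short lattice vectors span the hyperplane, which is not contained in x_i = 0, so one
  of them has a nonzero integer as its i-th entry. The coordinate estimate for that vector is the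
  claim.\<close>

lemma norm_le_successive_minimum_norm_delete:
  fixes a :: "nat ^ 'n"
  assumes pos: "\<And>i. 0 < a $ i" and N: "2 \<le> CARD('n)"
  shows "norm (real_vec a) \<le> successive_minimum a (CARD('n) - 1) * norm_delete a i"
proof -
  define l where "l = successive_minimum a (CARD('n) - 1)"
  define S where "S = cball 0 l \<inter> orth_lattice a"
  have S: "span S = lattice_space a"
    unfolding S_def l_def by (rule successive_minimum_spec(1)[OF pos N])
  have "\<exists>v\<in>S. v $ i \<noteq> 0"
  proof (rule ccontr)
    assume "\<not> (\<exists>v\<in>S. v $ i \<noteq> 0)"
    then have sub: "lattice_space a \<subseteq> {x. axis i 1 \<bullet> x = 0}"
      unfolding S[symmetric] by (intro span_minimal subspace_hyperplane) (auto simp: inner_axis')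
    obtain j where j: "j \<noteq> i"
      using N card_mono[of "{i}" UNIV] by fastforce
    define v where "v = real (a $ i) *\<^sub>R axis j 1 - real (a $ j) *\<^sub>R axis i (1::real)"
    have "v \<in> lattice_space a"
      by (simp add: lattice_space_eq[OF pos] v_def inner_diff_right inner_axis real_vec_def)
    with sub have "v $ i = 0"
      by (auto simp: inner_axis')
    then show False
      using pos[of j] j by (simp add: v_def axis_def)
  qed
  then obtain v where v: "v \<in> S" "v $ i \<noteq> 0"
    by blast
  then have "1 \<le> \<bar>v $ i\<bar>"
    by (auto simp: S_def orth_lattice_iff intro!: Ints_nonzero_abs_ge1)
  then have "norm (real_vec a) * 1 \<le> norm (real_vec a) * \<bar>v $ i\<bar>"
    by (intro mult_left_mono) auto
  also have "\<dots> \<le> norm_delete a i * norm v"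
    using v(1) S by (intro lattice_space_coordinate_le[OF pos]) (auto intro: span_base)
  also have "\<dots> \<le> norm_delete a i * l"
    using v(1) by (intro mult_left_mono) (auto simp: S_def norm_delete_def)
  finally show ?thesis
    by (simp add: l_def mult.commute)
qed

text \<open>The value of t at which the inradius of the simplex x >= 0, a . x = t equals the
  successive minimum.\<close>

definition lattice_scale :: "nat ^ 'n \<Rightarrow> real" where
  "lattice_scale a = successive_minimum a (CARD('n) - 1)
    * (\<Sum>i\<in>UNIV. norm_delete a i * real (a $ i)) / norm (real_vec a)"

text \<open>Lets the scale absorb the sum of the a_i by which \<open>card_weighted_vec_le\<close>
  enlarges the simplex.\<close>

lemma sum_le_lattice_scale:
  fixes a :: "nat ^ 'n"
  assumes pos: "\<And>i. 0 < a $ i" and N: "2 \<le> CARD('n)"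
  shows "real (\<Sum>i\<in>UNIV. a $ i) \<le> lattice_scale a"
proof -
  have "norm (real_vec a) * real (\<Sum>i\<in>UNIV. a $ i) = (\<Sum>i\<in>UNIV. norm (real_vec a) * real (a $ i))"
    by (simp add: sum_distrib_left)
  also have "\<dots> \<le> (\<Sum>i\<in>UNIV. successive_minimum a (CARD('n) - 1) * norm_delete a i * real (a $ i))"
    by (intro sum_mono mult_right_mono norm_le_successive_minimum_norm_delete[OF pos N]) simp
  also have "\<dots> = norm (real_vec a) * lattice_scale a"
    using norm_real_vec_pos[OF pos] by (simp add: lattice_scale_def mult.assoc flip: sum_distrib_left)
  finally show ?thesis
    using norm_real_vec_pos[OF pos] by simp
qed

lemma lattice_scale_nonneg:
  fixes a :: "nat ^ 'n"
  assumes "\<And>i. 0 < a $ i" and "2 \<le> CARD('n)"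
  shows "0 \<le> lattice_scale a"
  using order_trans[OF of_nat_0_le_iff sum_le_lattice_scale[OF assms]] .

text \<open>Below, \<open>p\<close> is the incenter and \<open>r\<close> the inradius of the simplex \<open>x \<ge> 0\<close>, \<open>a \<bullet> x = t\<close>: within the
  hyperplane, the distance of \<open>p\<close> to the facet \<open>x\<^sub>i = 0\<close> is \<open>p\<^sub>i \<parallel>a\<parallel> / \<parallel>\<alpha>\<^sub>i\<parallel>\<close>.\<close>

lemma representations_nonempty:
  fixes a :: "nat ^ 'n"
  assumes pos: "\<And>i. 0 < a $ i" and N: "2 \<le> CARD('n)" and gcd: "Gcd (range (\<lambda>i. a $ i)) = 1"
    and t: "real (CARD('n) - 1) / 2 * lattice_scale a \<le> real t"
  shows "representations a t \<noteq> {}"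
proof -
  define A where "A = norm (real_vec a)"
  define D where "D = norm_delete a"
  define Sg where "Sg = (\<Sum>i\<in>UNIV. D i * real (a $ i))"
  define r where "r = real t * A / Sg"
  define e where "e = real (CARD('n) - 1) / 2 * successive_minimum a (CARD('n) - 1)"
  have A: "0 < A"
    unfolding A_def by (rule norm_real_vec_pos[OF pos])
  have D0: "0 \<le> D i" for i
    by (simp add: D_def norm_delete_def)
  have "D i \<noteq> 0" for i
    using norm_le_successive_minimum_norm_delete[OF pos N, of i] A by (auto simp: D_def A_def)
  with D0 have D: "0 < D i" for i
    by (simp add: less_le)
  have Sg: "0 < Sg"
    unfolding Sg_def using D pos by (intro sum_pos) auto
  have "e * Sg \<le> real t * A"
    using t A by (simp add: lattice_scale_def e_def Sg_def A_def D_def field_simps)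
  \<comment> \<open>The hypothesis on t says exactly that the rounding error fits inside the
    inscribed ball.\<close>
  then have er: "e \<le> r"
    using Sg by (simp add: r_def field_simps)
  define p :: "real ^ 'n" where "p = (\<chi> i. r * D i / A)"
  have "real_vec a \<bullet> p = r * Sg / A"
    by (simp add: real_vec_inner p_def Sg_def sum_distrib_left sum_divide_distrib mult_ac)
  also have "\<dots> = real t"
    using A Sg by (simp add: r_def)
  finally have ap: "real_vec a \<bullet> p = real t" .
  obtain c where c: "(\<Sum>i\<in>UNIV. c i * int (a $ i)) = 1"
    using bezout_finite_family[of UNIV "\<lambda>i. a $ i"] gcd by auto
  define x0 :: "real ^ 'n" where "x0 = (\<chi> i. real_of_int (c i * int t))"
  have "real_vec a \<bullet> x0 = real_of_int ((\<Sum>i\<in>UNIV. c i * int (a $ i)) * int t)"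
    by (simp add: real_vec_inner x0_def sum_distrib_left mult_ac)
  then have ax0: "real_vec a \<bullet> x0 = real t"
    by (simp add: c)
  \<comment> \<open>Rounding the difference moves the integer point \<open>x0\<close> to an integer
    point of the same hyperplane within e of the incenter.\<close>
  have "p - x0 \<in> lattice_space a"
    by (simp add: lattice_space_eq[OF pos] inner_diff_right ap ax0)
  then obtain y where y: "y \<in> orth_lattice a" "norm (p - x0 - y) \<le> e"
    unfolding e_def by (rule lattice_rounding[OF pos N])
  define x where "x = x0 + y"
  have ax: "real_vec a \<bullet> x = real t"
    using y(1) by (simp add: x_def inner_add_right ax0 orth_lattice_iff)
  have x_Ints: "x $ i \<in> \<int>" for i
    using y(1) by (auto simp: x_def x0_def orth_lattice_iff intro!: Ints_add)
  have x_nonneg: "0 \<le> x $ i" for i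
  proof -
    have "p - x \<in> lattice_space a"
      by (simp add: lattice_space_eq[OF pos] inner_diff_right ap ax)
    then have "A * \<bar>(p - x) $ i\<bar> \<le> D i * norm (p - x)"
      unfolding A_def D_def by (rule lattice_space_coordinate_le[OF pos])
    also have "\<dots> \<le> D i * r"
      using y(2) er D0 by (intro mult_left_mono) (auto simp: x_def algebra_simps)
    also have "\<dots> = A * p $ i"
      using A by (simp add: p_def)
    finally have "\<bar>(p - x) $ i\<bar> \<le> p $ i"
      using A by simp
    then show ?thesis
      by simp
  qed
  define z :: "nat ^ 'n" where "z = (\<chi> i. nat \<lfloor>x $ i\<rfloor>)"
  have z: "real (z $ i) = x $ i" for i
    using x_Ints[of i] x_nonneg[of i] by (auto simp: z_def elim!: Ints_cases)
  have "real (\<Sum>i\<in>UNIV. a $ i * z $ i) = real t"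
    using ax by (simp add: real_vec_inner z)
  then have "z \<in> representations a t"
    by (simp only: representations_def mem_Collect_eq of_nat_eq_iff)
  then show ?thesis
    by blast
qed

section \<open>Growth of the number of representations and an upper bound for it\<close>

lemma card_representations_mono:
  fixes a :: "nat ^ 'n"
  assumes pos: "\<And>i. 0 < a $ i" and "representations a d \<noteq> {}"
  shows "card (representations a t) \<le> card (representations a (t + d))"
proof -
  obtain y where y: "y \<in> representations a d"
    using assms by blast
  have "inj_on (\<lambda>x. x + y) (representations a t)"
    by (auto simp: inj_on_def)
  moreover have "(\<lambda>x. x + y) ` representations a t \<subseteq> representations a (t + d)"
    using y by (auto simp: representations_def algebra_simps sum.distrib)
  ultimately show ?thesis
    using finite_representations[OF pos] by (metis card_inj_on_le)
qed

text \<open>The surplus K a_i a_j can be paid by k a_j further units in coordinate i and (K - k) a_i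
  in coordinate j, for each k from 0 to K. Hence the counts are unbounded, and each value is taken
  finitely often.\<close>

lemma card_representations_ge:
  fixes a :: "nat ^ 'n"
  assumes pos: "\<And>i. 0 < a $ i" and ij: "i \<noteq> j" and "representations a t \<noteq> {}"
  shows "K < card (representations a (t + K * a $ i * a $ j))"
proof -
  obtain x where x: "x \<in> representations a t"
    using assms by blast
  define f where "f k = (\<chi> l. x $ l + (if l = i then k * a $ j else 0)
    + (if l = j then (K - k) * a $ i else 0))" for k
  have "f k \<in> representations a (t + K * a $ i * a $ j)" if "k \<le> K" for k
  proof -
    have "(\<Sum>l\<in>UNIV. a $ l * f k $ l) = t + k * (a $ i * a $ j) + (K - k) * (a $ i * a $ j)"
      using x by (simp add: f_def representations_def algebra_simps sum.distrib
          if_distrib[of "\<lambda>x. _ * x"] cong: if_cong)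
    also have "\<dots> = t + K * a $ i * a $ j"
      using that by (simp add: mult.assoc add.assoc flip: add_mult_distrib)
    finally show ?thesis
      by (simp add: representations_def)
  qed
  then have "f ` {..K} \<subseteq> representations a (t + K * a $ i * a $ j)"
    by blast
  moreover have "inj_on f {..K}"
  proof (rule inj_onI)
    fix k k' assume "f k = f k'"
    then have "f k $ i = f k' $ i"
      by simp
    then show "k = k'"
      using ij pos[of j] by (simp add: f_def)
  qed
  ultimately have "card {..K} \<le> card (representations a (t + K * a $ i * a $ j))"
    using finite_representations[OF pos] by (metis card_inj_on_le)
  then show ?thesis
    by simp
qed

lemma finite_representation_count:
  fixes a :: "nat ^ 'n"
  assumes pos: "\<And>i. 0 < a $ i" and N: "2 \<le> CARD('n)" and gcd: "Gcd (range (\<lambda>i. a $ i)) = 1"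
  shows "finite {t. 0 < t \<and> card (representations a t) = s}"
proof -
  obtain i j :: 'n where ij: "i \<noteq> j"
    using N card_le_Suc0_iff_eq[of "UNIV :: 'n set"] by fastforce
  define X where "X = nat \<lceil>real (CARD('n) - 1) / 2 * lattice_scale a\<rceil>"
  have "t \<le> X + s * a $ i * a $ j" if "card (representations a t) = s" for t
  proof (rule ccontr)
    assume "\<not> t \<le> X + s * a $ i * a $ j"
    then obtain d where d: "t = X + d + s * a $ i * a $ j"
      by (metis add.assoc add.commute le_add_diff_inverse nle_le)
    have "real (CARD('n) - 1) / 2 * lattice_scale a \<le> real (X + d)"
      unfolding X_def by linarith
    from card_representations_ge[OF pos ij representations_nonempty[OF pos N gcd this], of s]
    show False
      using that d by simp
  qed
  then have "{t. 0 < t \<and> card (representations a t) = s} \<subseteq> {..X + s * a $ i * a $ j}"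
    by auto
  then show ?thesis
    by (rule finite_subset) simp
qed

text \<open>The m shifted targets t + X + k each have at least as many representations as t, and
  their disjoint representation sets lie in one full-dimensional simplex. The length m of the window
  is left free.\<close>

lemma card_representations_average_le:
  fixes a :: "nat ^ 'n"
  assumes pos: "\<And>i. 0 < a $ i" and N: "2 \<le> CARD('n)" and gcd: "Gcd (range (\<lambda>i. a $ i)) = 1"
    and m: "0 < m"
  shows "real (card (representations a t)) * real m * (fact CARD('n) * (\<Prod>i\<in>UNIV. real (a $ i)))
    \<le> (real t + real (CARD('n) - 1) / 2 * lattice_scale a + lattice_scale a + real m) ^ CARD('n)"
proof -
  define X where "X = nat \<lceil>real (CARD('n) - 1) / 2 * lattice_scale a\<rceil>"
  define Z where "Z = {z. (\<Sum>i\<in>UNIV. a $ i * z $ i) \<le> t + X + (m - 1)}"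
  have scale: "real (\<Sum>i\<in>UNIV. a $ i) \<le> lattice_scale a"
    by (rule sum_le_lattice_scale[OF pos N])
  have scale0: "0 \<le> real (CARD('n) - 1) / 2 * lattice_scale a"
    using lattice_scale_nonneg[OF pos N] by simp
  have "m * card (representations a t) = (\<Sum>k<m. card (representations a t))"
    by simp
  also have "\<dots> \<le> (\<Sum>k<m. card (representations a (t + (X + k))))"
  proof (intro sum_mono card_representations_mono[OF pos] representations_nonempty[OF pos N gcd])
    fix k show "real (CARD('n) - 1) / 2 * lattice_scale a \<le> real (X + k)"
      unfolding X_def by linarith
  qed
  also have "\<dots> = card (\<Union>k<m. representations a (t + (X + k)))"
    using finite_representations[OF pos]
    by (intro card_UN_disjoint[symmetric]) (auto simp: representations_def)
  also have "\<dots> \<le> card Z"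
    using card_weighted_vec_le(1)[OF pos]
    by (intro card_mono) (auto simp: Z_def representations_def)
  finally have "real (card (representations a t)) * real m \<le> real (card Z)"
    by (metis mult.commute of_nat_le_iff of_nat_mult)
  then have "real (card (representations a t)) * real m * (fact CARD('n) * (\<Prod>i\<in>UNIV. real (a $ i)))
      \<le> real (card Z) * (fact CARD('n) * (\<Prod>i\<in>UNIV. real (a $ i)))"
    by (rule mult_right_mono) (intro mult_nonneg_nonneg prod_nonneg; simp)
  also have "\<dots> \<le> real (t + X + (m - 1) + (\<Sum>i\<in>UNIV. a $ i)) ^ CARD('n)"
    unfolding Z_def by (rule card_weighted_vec_le(2)[OF pos])
  also have "\<dots> \<le> (real t + real (CARD('n) - 1) / 2 * lattice_scale a + lattice_scale a + real m) ^ CARD('n)"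
  proof (rule power_mono)
    \<comment> \<open>The 1 lost to the ceiling is regained from m - 1, the last shift in the
      window.\<close>
    have "real X \<le> real (CARD('n) - 1) / 2 * lattice_scale a + 1"
      using scale0 unfolding X_def by linarith
    moreover have "real (m - 1) = real m - 1"
      using m by simp
    ultimately show "real (t + X + (m - 1) + (\<Sum>i\<in>UNIV. a $ i))
        \<le> real t + real (CARD('n) - 1) / 2 * lattice_scale a + lattice_scale a + real m"
      using scale unfolding of_nat_add by linarith
  qed (rule of_nat_0_le_iff)
  finally show ?thesis .
qed

text \<open>The numerical comparison for \<open>card_representations_less\<close>. For n >= 2, 9/4
  (n/2 + 2) is at most 4 n and 9/4 is below 2 (n + 1); the first inequality fails for n = 1, which
  is checked directly.\<close>

lemma nine_quarters_power_less:
  fixes c :: real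
  assumes "1 \<le> n" "real n \<le> c"
  shows "(9/4) ^ Suc n * (real n / 2 + 2) ^ n < 2 * real (Suc n) * (4 * c) ^ n"
proof (cases "n = 1")
  case True
  then show ?thesis
    using assms by (simp add: power2_eq_square)
next
  case False
  then have n: "2 \<le> n"
    using assms by simp
  have "(9/4 * (real n / 2 + 2)) ^ n \<le> (4 * c) ^ n"
    using n assms by (intro power_mono) auto
  then have "9/4 * (9/4 * (real n / 2 + 2)) ^ n \<le> 9/4 * (4 * c) ^ n"
    by simp
  also have "\<dots> < 2 * real (Suc n) * (4 * c) ^ n"
    using n assms by (intro mult_strict_right_mono zero_less_power) auto
  finally show ?thesis
    unfolding power_mult_distrib power_Suc by (simp only: mult.assoc)
qed

lemma card_representations_less:
  fixes a :: "nat ^ 'n"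
  assumes pos: "\<And>i. 0 < a $ i" and gcd: "Gcd (range (\<lambda>i. a $ i)) = 1"
    and n: "CARD('n) = Suc n" "1 \<le> n" and t: "0 < t" and c: "real n \<le> c"
  shows "real (card (representations a t)) * fact n * (\<Prod>i\<in>UNIV. real (a $ i))
    < 2 * (4 * c * max (real t) (lattice_scale a)) ^ n"
proof -
  define T where "T = lattice_scale a"
  define M where "M = max (real t) T"
  define P where "P = (\<Prod>i\<in>UNIV. real (a $ i))"
  define p where "p = real (card (representations a t))"
  define Y where "Y = real t + real n / 2 * T + T"
  define m where "m = nat \<lceil>Y\<rceil>"
  have N: "2 \<le> CARD('n)"
    using n by simp
  have "card (UNIV :: 'n set) \<le> (\<Sum>i\<in>UNIV. a $ i)"
    using sum_mono[of UNIV "\<lambda>_. 1" "\<lambda>i. a $ i"] pos by (simp add: Suc_leI)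
  then have "2 \<le> real (\<Sum>i\<in>UNIV. a $ i)"
    using N by linarith
  then have T: "2 \<le> T"
    using sum_le_lattice_scale[OF pos N] by (simp add: T_def)
  have "1 * 1 \<le> real n / 2 * T"
    using mult_mono[of 1 "real n" 2 T] n T by simp
  then have Y: "4 \<le> Y"
    using T t by (simp add: Y_def)
  \<comment> \<open>Rounding up costs at most 1, which is at most Y/4; hence Y + m is at most 9/4
    Y.\<close>
  have m: "Y \<le> real m" "real m \<le> 5/4 * Y" "0 < m"
    using Y unfolding m_def by linarith+
  have M: "0 < M"
    using t by (simp add: M_def)
  have "Y \<le> M + real n / 2 * M + M"
    unfolding Y_def using T by (intro add_mono mult_left_mono) (auto simp: M_def)
  then have YM: "Y \<le> (real n / 2 + 2) * M"
    by (simp add: algebra_simps)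
  have P: "0 \<le> P"
    by (simp add: P_def prod_nonneg)
  have "Y * (p * (fact (Suc n) * P)) \<le> real m * (p * (fact (Suc n) * P))"
    using m(1) P by (intro mult_right_mono) (auto simp: p_def)
  also have "\<dots> = p * real m * (fact (Suc n) * P)"
    by simp
  also have "\<dots> \<le> (Y + real m) ^ Suc n"
    using card_representations_average_le[OF pos N gcd m(3), of t]
    by (simp add: n(1) p_def P_def Y_def T_def del: fact_Suc power_Suc)
  also have "\<dots> \<le> (9/4 * Y) ^ Suc n"
    using m Y by (intro power_mono) auto
  also have "\<dots> = Y * ((9/4) ^ Suc n * Y ^ n)"
    unfolding power_mult_distrib by simp
  \<comment> \<open>Since m is at least Y, one factor Y cancels, and the exponent drops from N to N
    - 1.\<close>
  finally have "p * (fact (Suc n) * P) \<le> (9/4) ^ Suc n * Y ^ n"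
    using Y by simp
  also have "\<dots> \<le> (9/4) ^ Suc n * ((real n / 2 + 2) * M) ^ n"
    using YM Y by (intro mult_left_mono power_mono) auto
  also have "\<dots> = (9/4) ^ Suc n * (real n / 2 + 2) ^ n * M ^ n"
    by (simp add: power_mult_distrib)
  also have "\<dots> < 2 * real (Suc n) * (4 * c) ^ n * M ^ n"
    using nine_quarters_power_less[OF n(2) c] M by (intro mult_strict_right_mono) auto
  also have "\<dots> = real (Suc n) * (2 * (4 * c * M) ^ n)"
    by (simp add: power_mult_distrib)
  finally have "real (Suc n) * (p * fact n * P) < real (Suc n) * (2 * (4 * c * M) ^ n)"
    by (simp add: mult_ac)
  then have "p * fact n * P < 2 * (4 * c * M) ^ n"
    by (rule mult_left_less_imp_less) simp
  then show ?thesis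
    by (simp add: p_def P_def M_def T_def)
qed

section \<open>The lower bound for the s-Frobenius number\<close>

theorem theorem5p3:
  fixes a :: "nat ^ 'n" and N s :: nat
  assumes "N = CARD('n)" and "N \<ge> 2"
    and "\<And>i. a $ i > 0"
    and "Gcd (range (\<lambda>i. a $ i)) = 1"
    and "\<exists>t>0. card (representations a t) = s"
    and "real s \<ge>
      ((4 * successive_minimum a (N - 1) * (\<Sum>i\<in>UNIV. norm_delete a i * real (a $ i))) ^ (N - 1)
        * (real N - 1) powr ((3 * (real N)\<^sup>2 - 1) / 2))
      / (fact (N - 1) * norm (real_vec a) ^ (N - 2) * covering_radius a
          * (\<Prod>i\<in>UNIV. real (a $ i)))"
  shows "real (s_Frobenius s a) \<ge>
      fact (N - 2) powr (1 / (real N - 1)) / (4 * (real N - 1) powr (3 * (real N + 1) / 2))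
      * (real s * covering_radius a * (\<Prod>i\<in>UNIV. real (a $ i)) / norm (real_vec a))
          powr (1 / (real N - 1))"
proof -
  define k where "k = N - 2"
  define n where "n = Suc k"
  define t where "t = s_Frobenius s a"
  define R where "R = covering_radius a"
  define A where "A = norm (real_vec a)"
  define P where "P = (\<Prod>i\<in>UNIV. real (a $ i))"
  define T where "T = lattice_scale a"
  define c where "c = real n powr (3 * (real N + 1) / 2)"
  \<comment> \<open>The goal amounts to Q <= (4 c t)^n, after taking n-th roots.\<close>
  define Q where "Q = fact k * (real s * R * P / A)"
  define M where "M = max (real t) T"
  have N: "2 \<le> CARD('n)" "CARD('n) = Suc n" "N - 1 = n" "N - 2 = k" "real N = real n + 1" "1 \<le> n"
    using assms(1,2) by (auto simp: n_def k_def)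
  have pos: "\<And>i. 0 < a $ i" by (rule assms(3))
  \<comment> \<open>\<open>Max\<close> returns an element of the set because the set is finite and,
    by assumption, nonempty.\<close>
  have "t \<in> {t. 0 < t \<and> card (representations a t) = s}"
    unfolding t_def s_Frobenius_def
    using assms(5) by (intro Max_in finite_representation_count[OF pos N(1) assms(4)]) auto
  then have t: "0 < t" "card (representations a t) = s"
    by auto
  have A: "0 < A"
    unfolding A_def by (rule norm_real_vec_pos[OF pos])
  have P: "0 < P"
    unfolding P_def using pos by (simp add: prod_pos)
  have R: "0 \<le> R" "R \<le> real n / 2 * A"
    using covering_radius_bounds[OF pos N(1)] by (auto simp: R_def A_def N(2))
  have c: "real n \<le> c"
    unfolding c_def using N powr_mono[of 1 "3 * (real N + 1) / 2" "real n"] by simp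
  then have c0: "0 < c"
    using N by simp
  have Q: "0 \<le> Q"
    using R P A by (simp add: Q_def)
  have upper: "Q < (4 * c * M) ^ n"
  proof -
    have "n * A * Q = real s * fact n * P * R"
      using A by (simp add: Q_def n_def field_simps)
    also have "\<dots> \<le> real s * fact n * P * (real n / 2 * A)"
      using R P by (intro mult_left_mono) auto
    also have "\<dots> < 2 * (4 * c * M) ^ n * (real n / 2 * A)"
      using card_representations_less[OF pos assms(4) N(2,6) t(1) c] A N
      by (intro mult_strict_right_mono) (auto simp: t P_def M_def T_def)
    also have "\<dots> = n * A * (4 * c * M) ^ n"
      by simp
    finally show ?thesis
      using A N by (simp add: mult_less_cancel_left_pos)
  qed
  \<comment> \<open>If R were 0, the quotient in the hypothesis on s would be 0 by the convention on
    division and would carry no information; that case is settled below, where Q = 0.\<close>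
  have bound: "Q \<le> (4 * c * real t) ^ n" if "R \<noteq> 0"
  proof -
    define L where "L = successive_minimum a n * (\<Sum>i\<in>UNIV. norm_delete a i * real (a $ i))"
    have L: "L = T * A"
      using A by (simp add: T_def lattice_scale_def L_def A_def N)
    have "c ^ n = real n powr (3 * (real N + 1) / 2 * real n)"
      using powr_realpow[OF c0, of n] by (simp only: c_def powr_powr)
    \<comment> \<open>This splits the power of N - 1 in the hypothesis into c^n and one extra factor
      n, which completes (n - 1)! to n! below.\<close>
    moreover have "(3 * (real N)\<^sup>2 - 1) / 2 = 3 * (real N + 1) / 2 * real n + 1"
      by (simp add: N power2_eq_square field_simps)
    ultimately have "real n powr ((3 * (real N)\<^sup>2 - 1) / 2) = c ^ n * real n"
      using N(6) by (simp only: powr_add) simp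
    then have "(4 * L) ^ n * (c ^ n * real n) / (fact n * A ^ k * R * P) \<le> real s"
      using assms(6) unfolding N(3,4) by (simp add: N(5) L_def A_def R_def P_def mult.assoc)
    then have "(4 * L) ^ n * (c ^ n * real n) \<le> real s * (fact n * A ^ k * R * P)"
      using that R A P by (simp add: pos_divide_le_eq)
    moreover have "(4 * L) ^ n * (c ^ n * real n) = (4 * c * T) ^ n * (real n * A ^ n)"
      by (simp add: L power_mult_distrib)
    moreover have "real s * (fact n * A ^ k * R * P) = Q * (real n * A ^ n)"
      using A by (simp add: Q_def n_def)
    ultimately have "(4 * c * T) ^ n * (real n * A ^ n) \<le> Q * (real n * A ^ n)"
      by (simp only:)
    then have "(4 * c * T) ^ n \<le> Q"
      using A N by (simp add: mult_le_cancel_right_pos)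
    \<comment> \<open>The lower bound on s thus excludes that the maximum M is T, leaving M =
      t.\<close>
    then have "(4 * c * T) ^ n < (4 * c * M) ^ n"
      using upper by linarith
    then have "T \<noteq> M"
      by auto
    then have "M = real t"
      by (auto simp: M_def max_def split: if_splits)
    then show ?thesis
      using upper by simp
  qed
  have "Q powr (1 / real n) \<le> 4 * c * real t"
  proof (cases "R = 0")
    case True
    then show ?thesis
      using c0 by (simp add: Q_def)
  next
    case False
    have "Q powr (1 / real n) \<le> ((4 * c * real t) ^ n) powr (1 / real n)"
      using bound[OF False] Q by (intro powr_mono2) auto
    also have "\<dots> = (4 * c * real t) powr (real n * (1 / real n))"
      using c0 t(1) by (subst powr_realpow[symmetric]) (simp_all add: powr_powr)
    also have "\<dots> = 4 * c * real t"
      using c0 t(1) N(6) by simp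
    finally show ?thesis .
  qed
  then have "Q powr (1 / real n) / (4 * c) \<le> real t"
    using c0 by (simp add: pos_divide_le_eq mult_ac)
  moreover have "Q powr (1 / real n) = fact k powr (1 / real n) * (real s * R * P / A) powr (1 / real n)"
    unfolding Q_def by (rule powr_mult)
  ultimately show ?thesis
    by (simp add: N c_def t_def R_def P_def A_def)
qed

end
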